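(* Let $\mathcal X\subset\mathbb R$ be a nontrivial interval, $x_{1,n}\le\ldots\le x_{n,n}$ points of $\mathcal X$, and let $f\in\mathcal M_k$ with $k\ge1$, monotone on each element of a partition $\mathcal J$ of $\mathcal X$ into at most $k$ nontrivial intervals. For every $\gamma>0$, there exists an element $\overline f$ in $\mathcal O_{\mathrm{pc}}(\lfloor k+\gamma\rfloor)$ such that $$\frac1n\sum_{i=1}^n\left|f(x_{i,n})-\overline f(x_{i,n})\right|\le\frac{V_{\mathcal J}(\mathbf x,f)}{\gamma}.$$
   Context: A nontrivial interval is an interval of $\mathbb R$ with positive length. $\mathcal M_k$ is the class of functions on $\mathcal X$ that are $k$-piecewise monotone, i.e. monotone on each element of a partition of $\mathcal X$ into at most $k$ nontrivial intervals. A function is $K$-piecewise constant on $\mathcal X$ if it is constant on each element of a partition of $\mathcal X$ into at most $K$ nontrivial intervals. $\mathcal O_{\mathrm{pc}}(K)\subset\mathcal M_k$ is the set of functions which are both $k$-piecewise monotone and $K$-piecewise constant on $\mathcal X$. For $f\in\mathcal M_k$ with associated partition $\mathcal J$, the $\mathcal J$-variation is $$V_{\mathcal J}(\mathbf x,f)=\left(\sum_{J\in\mathcal J}\sqrt{\frac{n_JV_J(f)}{n}}\right)^2,\qquad V_J(f)=\sup_{x\in J}f(x)-\inf_{x\in J}f(x),$$ where $\mathbf x=(x_{1,n},\ldots,x_{n,n})$ and $n_J$ is the number of indices $i$ with $x_{i,n}\in J$ (with $0\cdot\infty=0$). $\lfloor x\rfloor$ is the largest integer not larger than $x$. *)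

theory Defs
  imports "HOL-Analysis.Analysis" "HOL-Library.Disjoint_Sets"
begin

definition nontrivial_interval :: "real set \<Rightarrow> bool" where
  "nontrivial_interval I \<longleftrightarrow> is_interval I \<and> (\<exists>a\<in>I. \<exists>b\<in>I. a < b)"

lemma nontrivial_interval_iff_positive_length:
  "nontrivial_interval I \<longleftrightarrow> is_interval I \<and> emeasure lborel I > 0"
proof
  assume I: "nontrivial_interval I"
  then obtain a b where ab: "a \<in> I" "b \<in> I" "a < b" and int: "is_interval I"
    by (auto simp: nontrivial_interval_def)
  have "{a..b} \<subseteq> I"
    using ab int unfolding is_interval_1 by (meson atLeastAtMost_iff subsetI)
  moreover have "I \<in> sets borel"
    using int by (simp add: real_interval_borel_measurable)
  ultimately have "emeasure lborel {a..b} \<le> emeasure lborel I"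
    by (intro emeasure_mono) auto
  moreover have "emeasure lborel {a..b} > 0"
    using ab by simp
  ultimately show "is_interval I \<and> emeasure lborel I > 0"
    using int by auto
next
  assume I: "is_interval I \<and> emeasure lborel I > 0"
  have "\<exists>a\<in>I. \<exists>b\<in>I. a < b"
  proof (rule ccontr)
    assume no: "\<not> ?thesis"
    have "I \<subseteq> {c}" if "c \<in> I" for c
      using no that by (metis insertI1 linorder_neqE_linordered_idom subsetI)
    then have "I = {} \<or> (\<exists>c. I = {c})"
      by blast
    then have "emeasure lborel I = 0"
      by auto
    with I show False
      by simp
  qed
  with I show "nontrivial_interval I"
    by (simp add: nontrivial_interval_def)
qed

definition interval_partition :: "real set \<Rightarrow> nat \<Rightarrow> real set set \<Rightarrow> bool" where
  "interval_partition X k P \<longleftrightarrow>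
     partition_on X P \<and> finite P \<and> card P \<le> k \<and> (\<forall>J\<in>P. nontrivial_interval J)"

text \<open>Functions on \<open>X\<close> are represented by total functions; the classes below only constrain
  the values on \<open>X\<close>. The direction of monotonicity may differ from one piece to another.\<close>

definition monotone_on_pieces :: "real set set \<Rightarrow> (real \<Rightarrow> real) \<Rightarrow> bool" where
  "monotone_on_pieces P f \<longleftrightarrow> (\<forall>J\<in>P. mono_on J f \<or> antimono_on J f)"

definition piecewise_monotone :: "real set \<Rightarrow> nat \<Rightarrow> (real \<Rightarrow> real) set" where
  "piecewise_monotone X k =
     {f. \<exists>P. interval_partition X k P \<and> monotone_on_pieces P f}"

definition piecewise_constant :: "real set \<Rightarrow> nat \<Rightarrow> (real \<Rightarrow> real) set" where
  "piecewise_constant X K =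
     {f. \<exists>P. interval_partition X K P \<and> (\<forall>J\<in>P. f constant_on J)}"

definition O_pc :: "real set \<Rightarrow> nat \<Rightarrow> nat \<Rightarrow> (real \<Rightarrow> real) set" where
  "O_pc X k K = piecewise_monotone X k \<inter> piecewise_constant X K"

text \<open>The variation on a piece can be infinite, since the pieces need not be compact.
  In \<open>ereal\<close> we have \<open>0 * \<infinity> = 0\<close>.\<close>

definition variation_on :: "real set \<Rightarrow> (real \<Rightarrow> real) \<Rightarrow> ereal" where
  "variation_on J f = (SUP x\<in>J. ereal (f x)) - (INF x\<in>J. ereal (f x))"

text \<open>Square root on \<open>[0, \<infinity>]\<close>, only applied to nonnegative arguments.\<close>

definition ereal_sqrt :: "ereal \<Rightarrow> ereal" where
  "ereal_sqrt a = (if a = \<infinity> then \<infinity> else ereal (sqrt (real_of_ereal a)))"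

definition num_points :: "nat \<Rightarrow> (nat \<Rightarrow> real) \<Rightarrow> real set \<Rightarrow> nat" where
  "num_points n x J = card {i \<in> {1..n}. x i \<in> J}"

definition partition_variation ::
    "real set set \<Rightarrow> nat \<Rightarrow> (nat \<Rightarrow> real) \<Rightarrow> (real \<Rightarrow> real) \<Rightarrow> ereal" where
  "partition_variation P n x f =
     (\<Sum>J\<in>P. ereal_sqrt (ereal (real (num_points n x J)) * variation_on J f / ereal (real n)))\<^sup>2"

end

theory Submission
  imports Defs
begin

text \<open>On a piece \<open>J\<close> the range of \<open>f\<close> is cut into \<open>D\<^sub>J\<close> bins of equal length, which gives a monotone
  step function with error at most \<open>V\<^sub>J / D\<^sub>J\<close> at the data points. Writing
  \<open>w\<^sub>J = sqrt (n\<^sub>J V\<^sub>J / n)\<close> and \<open>S = \<Sum>\<^sub>J w\<^sub>J\<close>, the choice \<open>D\<^sub>J = \<lfloor>1 + \<gamma> w\<^sub>J / S\<rfloor>\<close>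
  uses at most \<open>k + \<gamma>\<close> steps in total, and the error \<open>\<Sum>\<^sub>J w\<^sub>J\<^sup>2 / D\<^sub>J\<close> is at most
  \<open>\<Sum>\<^sub>J w\<^sub>J S / \<gamma> = S\<^sup>2 / \<gamma>\<close>.\<close>

section \<open>Monotone step functions on a single piece\<close>

lemma interval_partition_trivial:
  assumes "nontrivial_interval J" "D \<ge> 1"
  shows "interval_partition J D {J}"
  using assms by (auto simp: interval_partition_def partition_on_def nontrivial_interval_def)

text \<open>The level sets of the bins may be single points, so the cuts are made halfway between
  neighbouring data points of different bins: every cell then has positive length.\<close>

lemma step_approximation:
  fixes f :: "real \<Rightarrow> real" and a h :: real
  assumes "nontrivial_interval J" "finite A" "A \<subseteq> J" "mono_on A f" "h \<ge> 0" "D \<ge> 1"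
    and "\<forall>y\<in>A. a \<le> f y \<and> f y \<le> a + real D * h"
  shows "\<exists>Q g. interval_partition J D Q \<and> (\<forall>I\<in>Q. g constant_on I) \<and> mono_on J g
    \<and> (\<forall>y\<in>J. g y \<le> a + real D * h) \<and> (\<forall>y\<in>A. \<bar>f y - g y\<bar> \<le> h)"
  using assms(6,1-5,7)
\<comment> \<open>Induction on the number of bins. Removing the top bin leaves fewer data points and
  possibly a shorter interval, so \<open>J\<close> and \<open>A\<close> vary while \<open>f\<close>,
  \<open>a\<close> and \<open>h\<close> stay fixed. The bound on \<open>g\<close> over all of
  \<open>J\<close>, not only over \<open>A\<close>, is what makes the pasted function monotone at
  the cut.\<close>
proof (induction D arbitrary: J A rule: dec_induct)
  case base
  show ?case
    using base interval_partition_trivial[OF base(1), of 1]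
    by (intro exI[of _ "{J}"] exI[of _ "\<lambda>_. a"]) (auto simp: constant_on_def mono_on_def)
next
  case (step D)
  \<comment> \<open>The level \<open>t\<close> separates the lower \<open>D\<close> bins from the
    top bin, whose values lie in \<open>(t, t + h]\<close>. On the top bin the step function takes
    the upper end \<open>t + h\<close>.\<close>
  define t where "t = a + real D * h"
  have t': "a + real (Suc D) * h = t + h"
    by (simp add: t_def algebra_simps)
  define A1 where "A1 = {y\<in>A. f y \<le> t}"
  define A2 where "A2 = {y\<in>A. t < f y}"
  have A12: "A = A1 \<union> A2" "finite A1" "finite A2" "A1 \<subseteq> J" "A2 \<subseteq> J"
    using step.prems by (auto simp: A1_def A2_def)
  have err2: "\<bar>f y - (t + h)\<bar> \<le> h" if "y \<in> A2" for y
    using that step.prems(6) unfolding t' by (auto simp: A2_def)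
  show ?case
  proof (cases "A1 = {}")
    case True
    then show ?thesis
      unfolding t'
      using A12 err2 interval_partition_trivial[OF step.prems(1), of "Suc D"]
      by (intro exI[of _ "{J}"] exI[of _ "\<lambda>_. t + h"]) (auto simp: constant_on_def mono_on_def)
  next
    case A1ne: False
    have J: "is_interval J"
      using step.prems(1) by (simp add: nontrivial_interval_def)
    \<comment> \<open>The interval is left open: it is \<open>J\<close> itself if the top bin
      contains no data, and the part of \<open>J\<close> to the left of the cut otherwise.\<close>
    have IH: "\<exists>Q g. interval_partition J' D Q \<and> (\<forall>I\<in>Q. g constant_on I) \<and> mono_on J' g
        \<and> (\<forall>y\<in>J'. g y \<le> t) \<and> (\<forall>y\<in>A1. \<bar>f y - g y\<bar> \<le> h)"
      if "nontrivial_interval J'" "A1 \<subseteq> J'" for J'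
      unfolding t_def
    proof (rule step.IH)
      show "mono_on A1 f"
        using step.prems(4) by (rule mono_on_subset) (auto simp: A1_def)
      show "\<forall>y\<in>A1. a \<le> f y \<and> f y \<le> a + real D * h"
        using step.prems(6) by (auto simp: A1_def t_def)
    qed (use that A12 step.prems in auto)
    show ?thesis
    proof (cases "A2 = {}")
      case True
      then obtain Q g where Q: "interval_partition J D Q" "\<forall>I\<in>Q. g constant_on I" "mono_on J g"
        and g: "\<forall>y\<in>J. g y \<le> t" "\<forall>y\<in>A. \<bar>f y - g y\<bar> \<le> h"
        using IH[of J] step.prems(1) A12 by auto
      have "interval_partition J (Suc D) Q"
        using Q(1) by (simp add: interval_partition_def)
      moreover have "g y \<le> t + h" if "y \<in> J" for y
        using g(1)[rule_format, OF that] step.prems(5) by linarith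
      ultimately show ?thesis
        unfolding t' using Q(2,3) g(2) by blast
    next
      case A2ne: False
      define l where "l = Max A1"
      define r where "r = Min A2"
      define c where "c = (l + r) / 2"
      have l: "l \<in> A1" "\<forall>y\<in>A1. y \<le> l" and r: "r \<in> A2" "\<forall>y\<in>A2. r \<le> y"
        using A12 A1ne A2ne by (auto simp: l_def r_def)
      \<comment> \<open>Otherwise \<open>r\<close> \<le> \<open>l\<close>, and monotonicity on the
        data would give \<open>f r\<close> \<le> \<open>f l\<close> \<le> \<open>t\<close>,
        contradicting \<open>t < f r\<close>.\<close>
      have "l < r"
        using l(1) r(1) step.prems(4) by (force simp: A1_def A2_def mono_on_def not_le[symmetric])
      then have c: "l < c" "c < r"
        by (auto simp: c_def)
      define J1 where "J1 = J \<inter> {..<c}"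
      define J2 where "J2 = J \<inter> {c..}"
      have lr: "l \<in> J" "r \<in> J"
        using l r A12 by auto
      have mid: "y \<in> J" if "l \<le> y" "y \<le> r" for y
        using J lr that unfolding is_interval_1 by blast
      have "nontrivial_interval J1"
        unfolding nontrivial_interval_def J1_def
      proof
        \<comment> \<open>The cut \<open>c\<close> itself belongs to the right part, so the second
          witness is a point strictly between \<open>l\<close> and \<open>c\<close>.\<close>
        show "\<exists>a\<in>J \<inter> {..<c}. \<exists>b\<in>J \<inter> {..<c}. a < b"
          using mid c lr by (intro bexI[of _ l] bexI[of _ "(l + c) / 2"]) auto
      qed (use J in \<open>auto intro: is_interval_Int is_interval_io\<close>)
      moreover have J2: "nontrivial_interval J2"
        unfolding nontrivial_interval_def J2_def
      proof
        show "\<exists>a\<in>J \<inter> {c..}. \<exists>b\<in>J \<inter> {c..}. a < b"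
          using mid c lr by (intro bexI[of _ c] bexI[of _ r]) auto
      qed (use J in \<open>auto intro: is_interval_Int is_interval_ci\<close>)
      moreover have "A1 \<subseteq> J1"
      proof
        fix y assume "y \<in> A1"
        then show "y \<in> J1"
          using A12(4) l(2)[rule_format, of y] c(1) by (auto simp: J1_def)
      qed
      ultimately obtain Q g where Q: "interval_partition J1 D Q" "\<forall>I\<in>Q. g constant_on I"
        and g: "mono_on J1 g" "\<forall>y\<in>J1. g y \<le> t" "\<forall>y\<in>A1. \<bar>f y - g y\<bar> \<le> h"
        using IH by blast
      define g' where "g' y = (if y < c then g y else t + h)" for y
      have QJ1: "\<Union>Q = J1"
        using Q by (auto simp: interval_partition_def partition_on_def)
      have "J - J2 = J1" "J2 \<subseteq> J" "disjnt J2 (\<Union>Q)" "J2 \<noteq> {}"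
        using J2 unfolding QJ1 by (auto simp: J1_def J2_def disjnt_def nontrivial_interval_def)
      then have "partition_on J (insert J2 Q)"
        using Q(1) by (simp add: partition_on_insert interval_partition_def)
      then have "interval_partition J (Suc D) (insert J2 Q)"
        using Q(1) J2 by (auto simp: interval_partition_def card_insert_if)
      moreover have "g' constant_on I" if "I \<in> insert J2 Q" for I
        using that
      proof
        assume "I = J2"
        then show ?thesis
          by (auto simp: constant_on_def g'_def J2_def)
      next
        assume "I \<in> Q"
        then have "I \<subseteq> {..<c}" "g constant_on I"
          using QJ1 Q(2) by (auto simp: J1_def)
        then show ?thesis
          by (auto simp: constant_on_def g'_def subset_iff)
      qed
      moreover have bound: "g' y \<le> t + h" if "y \<in> J" for y
      proof (cases "y < c")
        case True
        then have "g y \<le> t"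
          using g(2) that by (simp add: J1_def)
        then show ?thesis
          using True step.prems(5) by (simp add: g'_def)
      qed (simp add: g'_def)
      moreover have "mono_on J g'"
      proof (rule mono_onI)
        fix y z assume yz: "y \<in> J" "z \<in> J" "y \<le> z"
        show "g' y \<le> g' z"
        proof (cases "z < c")
          case True
          then have "g y \<le> g z"
            using yz by (intro mono_onD[OF g(1)]) (auto simp: J1_def)
          then show ?thesis
            using True yz(3) by (simp add: g'_def)
        next
          case False
          then show ?thesis
            using bound[OF yz(1)] by (simp add: g'_def)
        qed
      qed
      moreover have "\<bar>f y - g' y\<bar> \<le> h" if "y \<in> A" for y
      proof (cases "y \<in> A1")
        case True
        then have "y < c"
          using l(2) c by (metis le_less_trans)
        then show ?thesis
          using g(3) True by (simp add: g'_def)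
      next
        case False
        then have "y \<in> A2"
          using that A12(1) by blast
        moreover from this have "\<not> y < c"
          using r(2) c by (metis less_le_trans less_asym)
        ultimately show ?thesis
          using err2 by (simp add: g'_def)
      qed
      ultimately show ?thesis
        unfolding t' by blast
    qed
  qed
qed

text \<open>The antimonotone case follows by reflection: \<open>- f\<close> is monotone with values
  on \<open>A\<close> between \<open>- (a + real D * h)\<close> and \<open>- a\<close>, and negating
  its step function preserves the cells and the error.\<close>

lemma step_approximation_piece:
  fixes f :: "real \<Rightarrow> real" and a h :: real
  assumes J: "nontrivial_interval J" and A: "finite A" "A \<subseteq> J"
    and f: "mono_on J f \<or> antimono_on J f" and h: "h \<ge> 0" and D: "D \<ge> 1"
    and bounds: "\<forall>y\<in>A. a \<le> f y \<and> f y \<le> a + real D * h"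
  shows "\<exists>Q g. interval_partition J D Q \<and> (\<forall>I\<in>Q. g constant_on I)
    \<and> (mono_on J g \<or> antimono_on J g) \<and> (\<forall>y\<in>A. \<bar>f y - g y\<bar> \<le> h)"
  using f
proof
  assume "mono_on J f"
  then have "mono_on A f"
    using A(2) by (rule mono_on_subset)
  from step_approximation[OF J A this h D bounds] show ?thesis
    by blast
next
  assume "antimono_on J f"
  then have "mono_on A (\<lambda>y. - f y)"
    using A(2) by (auto simp: monotone_on_def subset_iff)
  moreover have "\<forall>y\<in>A. - (a + real D * h) \<le> - f y \<and> - f y \<le> - (a + real D * h) + real D * h"
    using bounds by auto
  ultimately obtain Q g where Q: "interval_partition J D Q" "\<forall>I\<in>Q. g constant_on I"
    and g: "mono_on J g" "\<forall>y\<in>A. \<bar>- f y - g y\<bar> \<le> h"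
    using step_approximation[OF J A _ h D, of "\<lambda>y. - f y" "- (a + real D * h)"] by blast
  have "(\<lambda>y. - g y) constant_on I" if "I \<in> Q" for I
    using Q(2) that by (fastforce simp: constant_on_def)
  moreover have "antimono_on J (\<lambda>y. - g y)"
    using g(1) by (auto simp: monotone_on_def)
  moreover have "\<forall>y\<in>A. \<bar>f y - - g y\<bar> \<le> h"
    using g(2) by (auto simp: abs_minus_commute abs_le_iff)
  ultimately show ?thesis
    using Q(1) by blast
qed

section \<open>Refining a partition\<close>

lemma interval_partition_refine:
  assumes P: "interval_partition X k P" and Q: "\<And>J. J \<in> P \<Longrightarrow> interval_partition J (D J) (Q J)"
    and K: "(\<Sum>J\<in>P. D J) \<le> K"
  shows "interval_partition X K (\<Union>J\<in>P. Q J)"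
  unfolding interval_partition_def
proof (intro conjI ballI)
  have P': "partition_on X P" "finite P"
    using P by (auto simp: interval_partition_def)
  have Q': "partition_on J (Q J)" "finite (Q J)" "card (Q J) \<le> D J" if "J \<in> P" for J
    using Q[OF that] by (auto simp: interval_partition_def)
  have UQ: "\<Union>(Q J) = J" if "J \<in> P" for J
    using Q'(1)[OF that] by (auto simp: partition_on_def)
  show "partition_on X (\<Union>J\<in>P. Q J)"
  proof (rule partition_onI)
    show "\<Union>(\<Union>J\<in>P. Q J) = X"
    proof -
      have "\<Union>(\<Union>J\<in>P. Q J) = (\<Union>J\<in>P. \<Union>(Q J))"
        by blast
      then show ?thesis
        using P'(1) UQ by (simp add: partition_on_def)
    qed
    show "{} \<notin> (\<Union>J\<in>P. Q J)"
      using Q'(1) by (auto simp: partition_on_def)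
    show "disjnt p p'" if p: "p \<in> (\<Union>J\<in>P. Q J)" "p' \<in> (\<Union>J\<in>P. Q J)" "p \<noteq> p'" for p p'
    proof -
      obtain J J' where J: "J \<in> P" "p \<in> Q J" "J' \<in> P" "p' \<in> Q J'"
        using p by blast
      show ?thesis
      proof (cases "J = J'")
        case True
        then show ?thesis
          using J p(3) Q'(1)[of J] by (auto simp: partition_on_def disjoint_def disjnt_def)
      next
        case False
        then have "J \<inter> J' = {}"
          using J P'(1) by (auto simp: partition_on_def disjoint_def)
        then show ?thesis
          using UQ[OF J(1)] UQ[OF J(3)] J(2,4) unfolding disjnt_def by blast
      qed
    qed
  qed
  show "finite (\<Union>J\<in>P. Q J)"
    using P' Q' by blast
  have "card (\<Union>J\<in>P. Q J) \<le> (\<Sum>J\<in>P. card (Q J))"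
    using P'(2) by (rule card_UN_le)
  also have "\<dots> \<le> (\<Sum>J\<in>P. D J)"
    using Q'(3) by (rule sum_mono)
  finally show "card (\<Union>J\<in>P. Q J) \<le> K"
    using K by simp
  show "nontrivial_interval J" if "J \<in> (\<Union>J\<in>P. Q J)" for J
    using that Q by (auto simp: interval_partition_def)
qed

section \<open>Variation on a piece\<close>

lemma variation_on_nonneg:
  assumes "J \<noteq> {}"
  shows "variation_on J f \<ge> 0"
  unfolding variation_on_def
  using assms by (intro ereal_diff_positive INF_le_SUP)

text \<open>A value of \<open>f\<close> on a nonempty \<open>J\<close> lies between the infimum and
  the supremum, so these could be infinite only outwards, which would make their difference
  \<infinity>. Hence both are real, and \<open>a\<close> is the infimum.\<close>

lemma variation_on_finite_bounds:
  assumes "variation_on J f \<noteq> \<infinity>"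
  shows "\<exists>a. \<forall>y\<in>J. a \<le> f y \<and> f y \<le> a + real_of_ereal (variation_on J f)"
proof (cases "J = {}")
  case False
  then obtain z where z: "z \<in> J"
    by blast
  define s i where "s = (SUP y\<in>J. ereal (f y))" and "i = (INF y\<in>J. ereal (f y))"
  have le: "i \<le> ereal (f y)" "ereal (f y) \<le> s" if "y \<in> J" for y
    using that by (auto simp: s_def i_def intro: INF_lower SUP_upper)
  have var: "variation_on J f = s - i"
    by (simp add: variation_on_def s_def i_def)
  obtain s' i' where "s = ereal s'" "i = ereal i'"
    using le[OF z] assms unfolding var by (cases s; cases i) auto
  then show ?thesis
    using le unfolding var by (intro exI[of _ i']) auto
qed simp

section \<open>Distribution of the steps over the pieces\<close>

lemma bin_allocation:
  fixes w :: "'a \<Rightarrow> real" and \<gamma> :: real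
  assumes P: "finite P" "card P \<le> k" and w0: "\<And>J. J \<in> P \<Longrightarrow> w J \<ge> 0" and \<gamma>: "\<gamma> > 0"
  shows "\<exists>D. (\<Sum>J\<in>P. D J) \<le> nat \<lfloor>real k + \<gamma>\<rfloor>
    \<and> (\<forall>J\<in>P. D J \<ge> 1 \<and> (w J)\<^sup>2 / real (D J) \<le> w J * (\<Sum>J\<in>P. w J) / \<gamma>)"
proof -
  define S where "S = (\<Sum>J\<in>P. w J)"
  \<comment> \<open>If \<open>S = 0\<close>, division by zero yields 0, so every piece receives one
    step; all weights vanish then and the error bound reads 0 \<le> 0.\<close>
  define D where "D J = nat \<lfloor>1 + \<gamma> * w J / S\<rfloor>" for J
  have S0: "S \<ge> 0"
    unfolding S_def by (intro sum_nonneg w0)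
  have D1: "D J \<ge> 1" if "J \<in> P" for J
    using w0[OF that] S0 \<gamma> unfolding D_def by (intro le_nat_floor) simp
  \<comment> \<open>The summand 1 compensates for the loss in rounding down, and also guarantees at
    least one step on each piece.\<close>
  have Dge: "\<gamma> * w J / S \<le> real (D J)" for J
    unfolding D_def by linarith
  have Dle: "real (D J) \<le> 1 + \<gamma> * w J / S" if "J \<in> P" for J
    using w0[OF that] S0 \<gamma> unfolding D_def by (intro of_nat_floor) simp
  have "(\<Sum>J\<in>P. D J) \<le> nat \<lfloor>real k + \<gamma>\<rfloor>"
  proof (rule le_nat_floor)
    have "real (\<Sum>J\<in>P. D J) \<le> (\<Sum>J\<in>P. 1 + \<gamma> * w J / S)"
      using Dle by (simp add: sum_mono)
    also have "\<dots> = real (card P) + \<gamma> * S / S"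
      by (simp add: sum.distrib S_def sum_distrib_left sum_divide_distrib)
    also have "\<dots> \<le> real k + \<gamma>"
      using P(2) \<gamma> by (cases "S = 0") auto
    finally show "real (\<Sum>J\<in>P. D J) \<le> real k + \<gamma>" .
  qed
  moreover have "(w J)\<^sup>2 / real (D J) \<le> w J * S / \<gamma>" if J: "J \<in> P" for J
  proof (cases "S = 0")
    case True
    then have "w J = 0"
      using J P(1) w0 by (simp add: S_def sum_nonneg_eq_0_iff)
    then show ?thesis
      by simp
  next
    case False
    have "\<gamma> * w J \<le> real (D J) * S"
      using Dge[of J] False S0 by (simp add: field_simps)
    then have "w J * (\<gamma> * w J) \<le> w J * (real (D J) * S)"
      using w0[OF J] by (rule mult_left_mono)
    then show ?thesis
      using D1[OF J] \<gamma> by (simp add: field_simps power2_eq_square)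
  qed
  ultimately show ?thesis
    using D1 unfolding S_def by blast
qed

section \<open>Gluing the step functions of the pieces\<close>

text \<open>The two memberships in \<open>O_pc\<close> have different witnesses: the glued function
  is monotone on the pieces of the original \<open>P\<close>, which gives the count
  \<open>k\<close>, and constant on the cells of the refinement, which gives the count
  \<open>K\<close>.\<close>

lemma O_pc_glue:
  assumes P: "interval_partition X k P"
    and Q: "\<And>J. J \<in> P \<Longrightarrow> interval_partition J (D J) (Q J)"
      "\<And>J I. J \<in> P \<Longrightarrow> I \<in> Q J \<Longrightarrow> g J constant_on I"
    and g: "\<And>J. J \<in> P \<Longrightarrow> mono_on J (g J) \<or> antimono_on J (g J)"
    and K: "(\<Sum>J\<in>P. D J) \<le> K"
  shows "\<exists>h\<in>O_pc X k K. \<forall>J\<in>P. \<forall>y\<in>J. h y = g J y"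
proof -
  have uniq: "J = J'" if "J \<in> P" "J' \<in> P" "y \<in> J" "y \<in> J'" for J J' y
    using P that unfolding interval_partition_def partition_on_def disjoint_def by blast
  \<comment> \<open>The description is well defined on \<open>X\<close> because pieces are disjoint;
    outside \<open>X\<close> the value of \<open>h\<close> is arbitrary.\<close>
  define h where "h y = g (THE J. J \<in> P \<and> y \<in> J) y" for y
  have h: "h y = g J y" if "J \<in> P" "y \<in> J" for J y
  proof -
    have "(THE J. J \<in> P \<and> y \<in> J) = J"
      using that by (intro the_equality) (auto dest: uniq)
    then show ?thesis
      by (simp add: h_def)
  qed
  have "mono_on J h \<or> antimono_on J h" if "J \<in> P" for J
    using g[OF that] h[OF that] by (auto simp: monotone_on_def)
  then have "h \<in> piecewise_monotone X k"
    using P by (auto simp: piecewise_monotone_def monotone_on_pieces_def)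
  moreover have "h constant_on I" if "J \<in> P" "I \<in> Q J" for I J
  proof -
    have "I \<subseteq> J"
      using Q(1)[OF that(1)] that(2) by (auto simp: interval_partition_def partition_on_def)
    then show ?thesis
      using Q(2)[OF that] h[OF that(1)] by (auto simp: constant_on_def subset_iff)
  qed
  then have "h \<in> piecewise_constant X K"
    using interval_partition_refine[OF P Q(1) K] by (auto simp: piecewise_constant_def)
  ultimately show ?thesis
    using h by (auto simp: O_pc_def)
qed

section \<open>From extended to real sums, and from indices to pieces\<close>

text \<open>One infinite summand makes the whole sum infinite, so every piece containing data has
  finite variation. A piece without data may have infinite variation, but contributes 0 on both
  sides since \<open>0 * \<infinity> = 0\<close>. The variation can thus be computed with real
  numbers.\<close>

lemma partition_variation_finite:
  assumes P: "interval_partition X k P" and n: "n \<ge> 1"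
    and fin: "partition_variation P n x f \<noteq> \<infinity>"
  shows "\<forall>J\<in>P. num_points n x J \<noteq> 0 \<longrightarrow> variation_on J f \<noteq> \<infinity>"
    and "partition_variation P n x f = ereal
      ((\<Sum>J\<in>P. sqrt (real (num_points n x J) * real_of_ereal (variation_on J f) / real n))\<^sup>2)"
proof -
  define T where
    "T J = ereal (real (num_points n x J)) * variation_on J f / ereal (real n)" for J
  have V0: "variation_on J f \<ge> 0" if "J \<in> P" for J
    using P that by (intro variation_on_nonneg) (auto simp: interval_partition_def partition_on_def)
  have pv: "partition_variation P n x f = (\<Sum>J\<in>P. ereal_sqrt (T J))\<^sup>2"
    by (simp add: partition_variation_def T_def)
  have Tfin: "T J \<noteq> \<infinity>" if "J \<in> P" for J
  proof
    assume "T J = \<infinity>"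
    then have "(\<Sum>J\<in>P. ereal_sqrt (T J)) = \<infinity>"
      using P that by (auto simp: sum_Pinfty ereal_sqrt_def interval_partition_def)
    then show False
      using fin by (simp add: pv power2_eq_square)
  qed
  have Vfin: "variation_on J f \<noteq> \<infinity>" if "J \<in> P" "num_points n x J \<noteq> 0" for J
    using Tfin[OF that(1)] that(2) n by (auto simp: T_def divide_ereal_def)
  then show "\<forall>J\<in>P. num_points n x J \<noteq> 0 \<longrightarrow> variation_on J f \<noteq> \<infinity>"
    by blast
  have "ereal_sqrt (T J)
      = ereal (sqrt (real (num_points n x J) * real_of_ereal (variation_on J f) / real n))"
    if "J \<in> P" for J
  proof (cases "num_points n x J = 0")
    case True
    then show ?thesis
      by (simp add: T_def ereal_sqrt_def flip: zero_ereal_def)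
  next
    case False
    then show ?thesis
      using Vfin[OF that] V0[OF that] n
      by (cases "variation_on J f") (auto simp: T_def ereal_sqrt_def)
  qed
  then show "partition_variation P n x f = ereal
      ((\<Sum>J\<in>P. sqrt (real (num_points n x J) * real_of_ereal (variation_on J f) / real n))\<^sup>2)"
    by (simp add: pv)
qed

text \<open>The partition is pulled back along \<open>x\<close> to the indices, so coinciding data
  points are counted with multiplicity.\<close>

lemma sum_over_pieces:
  fixes F :: "nat \<Rightarrow> 'b::comm_monoid_add"
  assumes "interval_partition X k P" "\<forall>i\<in>{1..n}. x i \<in> X"
  shows "(\<Sum>i=1..n. F i) = (\<Sum>J\<in>P. \<Sum>i\<in>{i\<in>{1..n}. x i \<in> J}. F i)"
proof -
  have P: "partition_on X P" "finite P"
    using assms(1) by (auto simp: interval_partition_def)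
  have "{1..n} = (\<Union>J\<in>P. {i\<in>{1..n}. x i \<in> J})"
    using assms(2) P(1) by (auto simp: partition_on_def)
  then have "(\<Sum>i=1..n. F i) = sum F (\<Union>J\<in>P. {i\<in>{1..n}. x i \<in> J})"
    by (rule arg_cong)
  also have "\<dots> = (\<Sum>J\<in>P. \<Sum>i\<in>{i\<in>{1..n}. x i \<in> J}. F i)"
  proof (rule sum.UNION_disjoint)
    show "\<forall>J\<in>P. \<forall>J'\<in>P. J \<noteq> J' \<longrightarrow> {i\<in>{1..n}. x i \<in> J} \<inter> {i\<in>{1..n}. x i \<in> J'} = {}"
      using P(1) unfolding partition_on_def disjoint_def by blast
  qed (use P(2) in auto)
  finally show ?thesis .
qed

section \<open>Assembly of the global approximation\<close>

theorem proposition4: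
  fixes X :: "real set" and x :: "nat \<Rightarrow> real" and n k :: nat
    and f :: "real \<Rightarrow> real" and P :: "real set set" and \<gamma> :: real
  assumes "nontrivial_interval X"
    and "n \<ge> 1"
    and "\<forall>i\<in>{1..n}. x i \<in> X"
    and "mono_on {1..n} x"
    and "k \<ge> 1"
    and "f \<in> piecewise_monotone X k"
    and "interval_partition X k P"
    and "monotone_on_pieces P f"
    and "\<gamma> > 0"
  shows "\<exists>fbar \<in> O_pc X k (nat \<lfloor>real k + \<gamma>\<rfloor>).
           ereal (1 / real n * (\<Sum>i=1..n. \<bar>f (x i) - fbar (x i)\<bar>))
             \<le> partition_variation P n x f / ereal \<gamma>"
proof (cases "partition_variation P n x f = \<infinity>")
  \<comment> \<open>The right-hand side is infinite, so any element of the class will do; the zero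
    function is constant on the pieces of \<open>P\<close> itself.\<close>
  case True
  have "(\<lambda>_. 0) \<in> O_pc X k (nat \<lfloor>real k + \<gamma>\<rfloor>)"
  proof -
    have "k \<le> nat \<lfloor>real k + \<gamma>\<rfloor>"
      using assms(9) by (intro le_nat_floor) simp
    then have "interval_partition X (nat \<lfloor>real k + \<gamma>\<rfloor>) P"
      using assms(7) by (auto simp: interval_partition_def)
    then show ?thesis
      using assms(7)
      by (auto simp: O_pc_def piecewise_monotone_def piecewise_constant_def
        monotone_on_pieces_def constant_on_def mono_on_def)
  qed
  then show ?thesis
    using True assms(9) by (intro bexI[of _ "\<lambda>_. 0"]) (auto simp: divide_ereal_def)
next
  case False
  define N where "N J = {i\<in>{1..n}. x i \<in> J}" for J
  define v where "v J = real_of_ereal (variation_on J f)" for J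
  define w where "w J = sqrt (real (num_points n x J) * v J / real n)" for J
  have N: "finite (N J)" "num_points n x J = card (N J)" for J
    by (auto simp: N_def num_points_def)
  have P: "finite P" "card P \<le> k" "\<And>J. J \<in> P \<Longrightarrow> nontrivial_interval J"
    using assms(7) by (auto simp: interval_partition_def)
  have v0: "v J \<ge> 0" if "J \<in> P" for J
    using P(3)[OF that] unfolding v_def
    by (intro real_of_ereal_pos variation_on_nonneg) (auto simp: nontrivial_interval_def)
  note fin = partition_variation_finite[OF assms(7,2) False]
  have w0: "w J \<ge> 0" if "J \<in> P" for J
    using v0[OF that] by (simp add: w_def)
  from bin_allocation[of P k w \<gamma>, OF P(1,2) w0 assms(9)]
  obtain D where Dsum: "(\<Sum>J\<in>P. D J) \<le> nat \<lfloor>real k + \<gamma>\<rfloor>"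
    and D1: "\<And>J. J \<in> P \<Longrightarrow> D J \<ge> 1"
    and D2: "\<And>J. J \<in> P \<Longrightarrow> (w J)\<^sup>2 / real (D J) \<le> w J * (\<Sum>J\<in>P. w J) / \<gamma>"
    by blast
  \<comment> \<open>A single predicate allows cells and step function to be chosen together for all
    pieces. The bin length is \<open>v J / real (D J)\<close>.\<close>
  define good where "good J Q g \<longleftrightarrow> interval_partition J (D J) Q \<and> (\<forall>I\<in>Q. g constant_on I)
      \<and> (mono_on J g \<or> antimono_on J g) \<and> (\<forall>y\<in>x ` N J. \<bar>f y - g y\<bar> \<le> v J / real (D J))"
    for J Q g
  have "\<exists>Q g. good J Q g" if J: "J \<in> P" for J
  proof -
    \<comment> \<open>The range is needed only at the data points: without data in \<open>J\<close>
      the variation may be infinite and \<open>v J\<close> carries no information, but the claim is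
      then vacuous.\<close>
    have "\<exists>a. \<forall>y\<in>x ` N J. a \<le> f y \<and> f y \<le> a + real (D J) * (v J / real (D J))"
    proof (cases "N J = {}")
      case False
      then have "variation_on J f \<noteq> \<infinity>"
        using fin(1) J N by simp
      from variation_on_finite_bounds[OF this] show ?thesis
        using D1[OF J] by (fastforce simp: N_def v_def)
    qed simp
    then obtain a where "\<forall>y\<in>x ` N J. a \<le> f y \<and> f y \<le> a + real (D J) * (v J / real (D J))"
      by blast
    moreover have "mono_on J f \<or> antimono_on J f"
      using assms(8) J by (simp add: monotone_on_pieces_def)
    moreover have "x ` N J \<subseteq> J"
      by (auto simp: N_def)
    ultimately show ?thesis
      unfolding good_def using P(3)[OF J] N(1) v0[OF J] D1[OF J]
      by (intro step_approximation_piece[where a = a]) auto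
  qed
  then obtain Q g where "\<And>J. J \<in> P \<Longrightarrow> good J (Q J) (g J)"
    by metis
  then have
    Q: "\<And>J. J \<in> P \<Longrightarrow> interval_partition J (D J) (Q J)"
      "\<And>J I. J \<in> P \<Longrightarrow> I \<in> Q J \<Longrightarrow> g J constant_on I" and
    g: "\<And>J. J \<in> P \<Longrightarrow> mono_on J (g J) \<or> antimono_on J (g J)"
      "\<And>J y. J \<in> P \<Longrightarrow> y \<in> x ` N J \<Longrightarrow> \<bar>f y - g J y\<bar> \<le> v J / real (D J)"
    unfolding good_def by blast+
  from O_pc_glue[OF assms(7) Q g(1) Dsum]
  obtain fbar where fbar: "fbar \<in> O_pc X k (nat \<lfloor>real k + \<gamma>\<rfloor>)"
    "\<And>J y. J \<in> P \<Longrightarrow> y \<in> J \<Longrightarrow> fbar y = g J y"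
    by blast
  have "1 / real n * (\<Sum>i=1..n. \<bar>f (x i) - fbar (x i)\<bar>)
      = (\<Sum>J\<in>P. 1 / real n * (\<Sum>i\<in>N J. \<bar>f (x i) - fbar (x i)\<bar>))"
    unfolding sum_over_pieces[OF assms(7,3)] N_def by (rule sum_distrib_left)
  also have "\<dots> \<le> (\<Sum>J\<in>P. w J * (\<Sum>J\<in>P. w J) / \<gamma>)"
  proof (rule sum_mono)
    fix J assume J: "J \<in> P"
    have "(\<Sum>i\<in>N J. \<bar>f (x i) - fbar (x i)\<bar>) \<le> (\<Sum>i\<in>N J. v J / real (D J))"
      using g(2)[OF J] fbar(2)[OF J] by (intro sum_mono) (auto simp: N_def)
    then have "1 / real n * (\<Sum>i\<in>N J. \<bar>f (x i) - fbar (x i)\<bar>)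
        \<le> 1 / real n * (real (num_points n x J) * (v J / real (D J)))"
      by (intro mult_left_mono) (auto simp: N)
    \<comment> \<open>The weight \<open>w J\<close> was defined as a square root precisely so that
      its square is the number of points times \<open>v J\<close>, divided by
      \<open>n\<close>.\<close>
    also have "\<dots> = (w J)\<^sup>2 / real (D J)"
      using v0[OF J] by (simp add: w_def)
    also note D2[OF J]
    finally show "1 / real n * (\<Sum>i\<in>N J. \<bar>f (x i) - fbar (x i)\<bar>)
        \<le> w J * (\<Sum>J\<in>P. w J) / \<gamma>" .
  qed
  also have "\<dots> = (\<Sum>J\<in>P. w J)\<^sup>2 / \<gamma>"
    by (simp add: power2_eq_square sum_distrib_right sum_divide_distrib)
  finally have "ereal (1 / real n * (\<Sum>i=1..n. \<bar>f (x i) - fbar (x i)\<bar>))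
      \<le> partition_variation P n x f / ereal \<gamma>"
    using assms(9) by (simp add: fin(2) w_def v_def)
  with fbar(1) show ?thesis
    by blast
qed

end
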